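(* Let $\Gamma \cup \{\varphi\} \subseteq \mathfrak{F}_{\{\land\}}$. Then $\Gamma \vdash_{\{\land\}} \varphi$ if and only if $\Gamma \vDash_{\mathbf{2}} \varphi$.
   Context: Let $\Pi$ be an infinite set of propositional letters. $\mathfrak{F}_{\{\land\}}$ is the set of formulas built from $\Pi$ using only the binary connective $\land$. Derivability $\vdash_{\{\land\}}$ is the smallest relation between sets of formulas of $\mathfrak{F}_{\{\land\}}$ and formulas of $\mathfrak{F}_{\{\land\}}$ satisfying: (R$_\in$) if $\varphi \in \Gamma$, then $\Gamma \vdash \varphi$; (R$_m$) if $\Gamma \vdash \varphi$, then $\Gamma, \psi \vdash \varphi$; (R$_t$) if $\Gamma \vdash \varphi$ and $\Delta, \varphi \vdash \psi$, then $\Gamma, \Delta \vdash \psi$; (R$_\land$) $\Gamma \vdash \varphi \land \psi$ iff $\Gamma \vdash \varphi$ and $\Gamma \vdash \psi$. $\mathbf{2}$ is the algebra $\langle \{0,1\}; \land\rangle$ where $\land$ is the meet (minimum) for the order $0<1$, with set of designated values $D=\{1\}$. $\Gamma \vDash_{\mathbf{2}} \varphi$ means: for every assignment $v : \Pi \to \{0,1\}$, with unique homomorphic extension $\bar v : \mathfrak{F}_{\{\land\}} \to \{0,1\}$, if $\bar v(\psi) = 1$ for all $\psi \in \Gamma$, then $\bar v(\varphi) = 1$. *)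

theory Defs
  imports Main
begin

datatype 'p fm =
    Letter 'p
  | Conj "'p fm" "'p fm" (infixr "\<sqinter>\<^sub>f" 70)

(* Sets of premises may be infinite.  The biconditional rule for conjunction,
   "G |- a & b iff (G |- a and G |- b)", is the conjunction of its three Horn
   closure conditions: R_conjI, R_conjE1, R_conjE2. *)
inductive derives :: "'p fm set \<Rightarrow> 'p fm \<Rightarrow> bool" (infix "\<turnstile>\<^sub>f" 50) where
  R_in: "\<phi> \<in> \<Gamma> \<Longrightarrow> \<Gamma> \<turnstile>\<^sub>f \<phi>"
| R_m: "\<Gamma> \<turnstile>\<^sub>f \<phi> \<Longrightarrow> insert \<psi> \<Gamma> \<turnstile>\<^sub>f \<phi>"
| R_t: "\<Gamma> \<turnstile>\<^sub>f \<phi> \<Longrightarrow> insert \<phi> \<Delta> \<turnstile>\<^sub>f \<psi> \<Longrightarrow> \<Gamma> \<union> \<Delta> \<turnstile>\<^sub>f \<psi>"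
| R_conjI: "\<Gamma> \<turnstile>\<^sub>f \<phi> \<Longrightarrow> \<Gamma> \<turnstile>\<^sub>f \<psi> \<Longrightarrow> \<Gamma> \<turnstile>\<^sub>f \<phi> \<sqinter>\<^sub>f \<psi>"
| R_conjE1: "\<Gamma> \<turnstile>\<^sub>f \<phi> \<sqinter>\<^sub>f \<psi> \<Longrightarrow> \<Gamma> \<turnstile>\<^sub>f \<phi>"
| R_conjE2: "\<Gamma> \<turnstile>\<^sub>f \<phi> \<sqinter>\<^sub>f \<psi> \<Longrightarrow> \<Gamma> \<turnstile>\<^sub>f \<psi>"

(* The two-element algebra is the type bool with its library order False < True
   and meet inf; False plays the role of 0 and True of 1. *)
definition designated :: "bool set" where
  "designated = {True}"

primrec eval :: "('p \<Rightarrow> bool) \<Rightarrow> 'p fm \<Rightarrow> bool" where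
  "eval v (Letter p) = v p"
| "eval v (\<phi> \<sqinter>\<^sub>f \<psi>) = inf (eval v \<phi>) (eval v \<psi>)"

lemma eval_unique_homomorphic_extension:
  assumes "\<And>p. h (Letter p) = v p"
    and "\<And>\<phi> \<psi>. h (\<phi> \<sqinter>\<^sub>f \<psi>) = inf (h \<phi>) (h \<psi>)"
  shows "h = eval v"
proof
  fix \<phi>
  show "h \<phi> = eval v \<phi>"
    by (induction \<phi>) (simp_all only: assms eval.simps)
qed

definition entails :: "'p fm set \<Rightarrow> 'p fm \<Rightarrow> bool" (infix "\<Turnstile>\<^sub>2" 50) where
  "\<Gamma> \<Turnstile>\<^sub>2 \<phi> \<longleftrightarrow>
    (\<forall>v. (\<forall>\<psi>\<in>\<Gamma>. eval v \<psi> \<in> designated) \<longrightarrow> eval v \<phi> \<in> designated)"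

end

theory Submission imports Defs begin

text \<open>
  Soundness is an induction on derivations. For completeness, a set \<open>\<Gamma>\<close> of premises already
  determines a valuation: make true exactly the letters derivable from \<open>\<Gamma>\<close>. The conjunction
  rule, read in both directions, says that derivability from \<open>\<Gamma>\<close> commutes with \<open>\<sqinter>\<^sub>f\<close>, so it is
  itself a homomorphism into the two-element algebra and therefore the homomorphic extension of
  that valuation (\<open>eval_letters_derivable\<close>). This valuation satisfies \<open>\<Gamma>\<close>, and so makes every
  consequence of \<open>\<Gamma>\<close> true, which means derivable.
\<close>

lemma derives_sound:
  assumes "\<Gamma> \<turnstile>\<^sub>f \<phi>"
  shows "\<Gamma> \<Turnstile>\<^sub>2 \<phi>"
  using assms by induction (auto simp: entails_def designated_def)

lemma derives_Conj_iff: "\<Gamma> \<turnstile>\<^sub>f \<phi> \<sqinter>\<^sub>f \<psi> \<longleftrightarrow> \<Gamma> \<turnstile>\<^sub>f \<phi> \<and> \<Gamma> \<turnstile>\<^sub>f \<psi>"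
  by (blast intro: R_conjI R_conjE1 R_conjE2)

text \<open>
  Derivability from a fixed set is a homomorphism to the two-element algebra, and a homomorphism
  is determined by its values on the letters.
\<close>

lemma eval_letters_derivable: "eval (\<lambda>p. \<Gamma> \<turnstile>\<^sub>f Letter p) = (\<lambda>\<phi>. \<Gamma> \<turnstile>\<^sub>f \<phi>)"
  by (rule eval_unique_homomorphic_extension [symmetric]) (simp_all add: derives_Conj_iff)

lemma derives_complete:
  assumes "\<Gamma> \<Turnstile>\<^sub>2 \<phi>"
  shows "\<Gamma> \<turnstile>\<^sub>f \<phi>"
proof -
  let ?v = "\<lambda>p. \<Gamma> \<turnstile>\<^sub>f Letter p"
  have "\<forall>\<psi>\<in>\<Gamma>. eval ?v \<psi> \<in> designated"
    by (simp add: eval_letters_derivable designated_def R_in)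
  with assms have "eval ?v \<phi> \<in> designated"
    by (simp add: entails_def)
  then show ?thesis
    by (simp add: eval_letters_derivable designated_def)
qed

theorem proposition3:
  fixes \<Gamma> :: "'p fm set" and \<phi> :: "'p fm"
  assumes "infinite (UNIV :: 'p set)"
  shows "\<Gamma> \<turnstile>\<^sub>f \<phi> \<longleftrightarrow> \<Gamma> \<Turnstile>\<^sub>2 \<phi>"
  by (blast intro: derives_sound derives_complete)

end
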